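(* Let $V$ be a finite set with $|V|>1$, let $(\mathsf Z_i : i\in V)$ be discrete random variables with entropy function $H$. Then $$R_{\mathrm{ACO}}(V)\ \ge\ \max_{i\in V}\big\{\varphi(\{\{i\},V\setminus\{i\}\}),\ \varphi(\{\{m\}:m\in V\})\big\},$$ $$R_{\mathrm{NCO}}(V)\ \ge\ \Big\lceil\max_{i\in V}\big\{\varphi(\{\{i\},V\setminus\{i\}\}),\ \varphi(\{\{m\}:m\in V\})\big\}\Big\rceil .$$
   Context: For $X\subseteq V$, $H(X)$ is the (finite) Shannon entropy of $(\mathsf Z_i: i\in X)$, $H(\emptyset)=0$, $H(X|Y)=H(X\cup Y)-H(Y)$. For $\mathbf r_V=(r_i:i\in V)\in\mathbb R^{|V|}$, $r(X)=\sum_{i\in X}r_i$. $\mathscr R_{\mathrm{CO}}(V)=\{\mathbf r_V\in\mathbb R^{|V|}: r(X)\ge H(X|V\setminus X)\ \forall X\subsetneq V\}$; $R_{\mathrm{ACO}}(V)=\min\{r(V):\mathbf r_V\in\mathscr R_{\mathrm{CO}}(V)\}$; $R_{\mathrm{NCO}}(V)=\min\{r(V):\mathbf r_V\in\mathscr R_{\mathrm{CO}}(V)\cap\mathbb Z^{|V|}\}$. For a partition $\mathcal P$ of $V$ with $|\mathcal P|>1$, $\varphi(\mathcal P)=\sum_{C\in\mathcal P}\frac{H(V)-H(C)}{|\mathcal P|-1}$. *)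

theory Defs
  imports "HOL-Probability.Probability"
begin

text \<open>
  The tuple \<open>(Z\<^sub>i : i \<in> X)\<close> is the extensional function \<open>\<lambda>i\<in>X. Z i \<omega>\<close>. The entropy of the library is
  an integral and has value 0 when that integral diverges, so it is the Shannon entropy of the
  tuple only under the predicate \<open>has_finite_entropy\<close> below. For \<open>X = {}\<close> the tuple is constant,
  hence \<open>H({}) = 0\<close> needs no separate clause.
\<close>

definition tuple :: "('v \<Rightarrow> 'a \<Rightarrow> 'b) \<Rightarrow> 'v set \<Rightarrow> 'a \<Rightarrow> 'v \<Rightarrow> 'b" where
  "tuple Z X = (\<lambda>\<omega>. \<lambda>i\<in>X. Z i \<omega>)"

context information_space
begin

definition joint_entropy :: "('v \<Rightarrow> 'a \<Rightarrow> 'b) \<Rightarrow> 'v set \<Rightarrow> real" where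
  "joint_entropy Z X = \<H>(tuple Z X)"

definition has_finite_entropy :: "('v \<Rightarrow> 'a \<Rightarrow> 'b) \<Rightarrow> 'v set \<Rightarrow> bool" where
  "has_finite_entropy Z X \<longleftrightarrow>
     finite_entropy (count_space (tuple Z X ` space M)) (tuple Z X)
       (\<lambda>z. prob {\<omega> \<in> space M. tuple Z X \<omega> = z})"

lemma joint_entropy_empty: "joint_entropy Z {} = 0"
proof -
  have "simple_distributed M (\<lambda>\<omega>. (\<lambda>_. undefined) :: 'b \<Rightarrow> 'c) (\<lambda>_. 1)"
    by (rule simple_distributedI) (auto simp: prob_space)
  from entropy_simple_distributed[OF this] show ?thesis
    by (simp add: joint_entropy_def tuple_def restrict_def not_empty)
qed

end

definition cond_entropy :: "('v set \<Rightarrow> real) \<Rightarrow> 'v set \<Rightarrow> 'v set \<Rightarrow> real" where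
  "cond_entropy H X Y = H (X \<union> Y) - H Y"

text \<open>Vectors indexed by \<open>V\<close> are the extensional functions on \<open>V\<close>.\<close>

definition R_CO :: "('v set \<Rightarrow> real) \<Rightarrow> 'v set \<Rightarrow> ('v \<Rightarrow> real) set" where
  "R_CO H V = {r \<in> V \<rightarrow>\<^sub>E UNIV. \<forall>X. X \<subset> V \<longrightarrow> sum r X \<ge> cond_entropy H X (V - X)}"

text \<open>The minima are genuine minima (least elements), not infima.\<close>

definition R_ACO :: "('v set \<Rightarrow> real) \<Rightarrow> 'v set \<Rightarrow> real" where
  "R_ACO H V = (LEAST s. s \<in> {sum r V | r. r \<in> R_CO H V})"

definition R_NCO :: "('v set \<Rightarrow> real) \<Rightarrow> 'v set \<Rightarrow> real" where
  "R_NCO H V = (LEAST s. s \<in> {sum r V | r. r \<in> R_CO H V \<inter> (V \<rightarrow>\<^sub>E \<int>)})"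

definition phi :: "('v set \<Rightarrow> real) \<Rightarrow> 'v set \<Rightarrow> 'v set set \<Rightarrow> real" where
  "phi H V P = (\<Sum>C\<in>P. (H V - H C) / (real (card P) - 1))"

end

theory Submission
  imports Defs
begin

text \<open>
  Summing the constraints \<open>r(V - C) \<ge> H(V) - H(C)\<close> over the blocks \<open>C\<close> of a partition \<open>P\<close> counts
  every coordinate \<open>|P| - 1\<close> times, so \<open>r(V) \<ge> \<phi>(P)\<close> for every feasible \<open>r\<close>. The minima are
  attained because the constraints on singletons bound every coordinate from below, so that the
  feasible vectors of bounded sum form a compact set.
\<close>

lemma sum_complements_partition:
  fixes f :: "'v \<Rightarrow> real"
  assumes "finite V" "partition_on V P"
  shows "(\<Sum>C\<in>P. sum f (V - C)) = (real (card P) - 1) * sum f V"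
proof -
  have "(\<Sum>C\<in>P. sum f (V - C)) = (\<Sum>C\<in>P. sum f V - sum f C)"
    using assms by (intro sum.cong) (auto simp: partition_on_def intro!: sum_diff)
  also have "\<dots> = real (card P) * sum f V - (\<Sum>C\<in>P. sum f C)"
    by (simp add: sum_subtractf)
  also have "(\<Sum>C\<in>P. sum f C) = sum f V"
    using sum.partition[OF assms, of f] by simp
  finally show ?thesis
    by (simp add: algebra_simps)
qed

lemma R_CO_D: "r \<in> R_CO H V \<Longrightarrow> X \<subset> V \<Longrightarrow> cond_entropy H X (V - X) \<le> sum r X"
  by (simp add: R_CO_def)

lemma phi_le_sum:
  assumes "finite V" "partition_on V P" "card P > 1" "r \<in> R_CO H V"
  shows "phi H V P \<le> sum r V"
proof -
  have "H V - H C \<le> sum r (V - C)" if "C \<in> P" for C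
  proof -
    \<comment> \<open>Nonemptiness of the block makes \<open>V - C\<close> a proper subset, so the
      constraint on it is available; the set conditioned on is then \<open>C\<close> itself.\<close>
    have "C \<noteq> {}" "C \<subseteq> V"
      using assms(2) that by (auto simp: partition_on_def)
    then have "V - C \<subset> V" "V - (V - C) = C" "V - C \<union> C = V"
      by auto
    with R_CO_D[OF assms(4), of "V - C"] show ?thesis
      by (simp add: cond_entropy_def)
  qed
  then have "(\<Sum>C\<in>P. H V - H C) \<le> (\<Sum>C\<in>P. sum r (V - C))"
    by (rule sum_mono)
  also note sum_complements_partition[OF assms(1,2)]
  finally show ?thesis
    using assms(3) by (simp add: phi_def divide_le_eq mult.commute sum_divide_distrib[symmetric])
qed

text \<open>A constant vector with a large enough entry from \<open>S\<close> satisfies all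
  constraints. It supplies the bound on \<open>sum r V\<close> that the compactness argument starts
  from.\<close>

lemma ex_R_CO:
  assumes "finite V" "\<And>c. \<exists>s\<in>S. c \<le> s"
  shows "\<exists>r. r \<in> R_CO H V \<inter> (V \<rightarrow>\<^sub>E S)"
proof -
  \<comment> \<open>The inserted 0 gives \<open>0 \<le> s\<close>, so that the sum of
    \<open>card X\<close> copies of \<open>s\<close> is at least \<open>s\<close> for nonempty
    \<open>X\<close>.\<close>
  define B where "B = Max (insert 0 ((\<lambda>X. cond_entropy H X (V - X)) ` Pow V))"
  obtain s where s: "s \<in> S" "B \<le> s"
    using assms(2) by blast
  have B: "0 \<le> B" "\<And>X. X \<subseteq> V \<Longrightarrow> cond_entropy H X (V - X) \<le> B"
    unfolding B_def using assms(1) by (auto intro!: Max_ge)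
  define r where "r = (\<lambda>i\<in>V. s)"
  have "cond_entropy H X (V - X) \<le> sum r X" if "X \<subset> V" for X
  proof (cases "X = {}")
    case True
    then show ?thesis by (simp add: cond_entropy_def)
  next
    case False
    have "finite X"
      using that assms(1) finite_subset by blast
    with False have "1 \<le> card X"
      by (simp add: Suc_leI card_gt_0_iff)
    moreover have "sum r X = real (card X) * s"
      using that by (simp add: r_def subset_eq psubset_eq)
    moreover have "0 \<le> s" "cond_entropy H X (V - X) \<le> s"
      using B(1) B(2)[of X] s(2) that by auto
    ultimately show ?thesis
      using mult_right_mono[of 1 "real (card X)" s] by simp
  qed
  then show ?thesis
    using s by (intro exI[of _ r]) (auto simp: R_CO_def r_def)
qed

text \<open>The set \<open>S\<close> of allowed entries treats real vectors (\<open>UNIV\<close>)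
  and integer vectors (\<open>\<int>\<close>) at once: closedness serves compactness, unboundedness
  above serves feasibility.\<close>

lemma R_CO_attains_min:
  fixes S :: "real set"
  assumes "finite V" "card V > 1" "closed S" "\<And>c. \<exists>s\<in>S. c \<le> s"
  shows "\<exists>r \<in> R_CO H V \<inter> (V \<rightarrow>\<^sub>E S). \<forall>r' \<in> R_CO H V \<inter> (V \<rightarrow>\<^sub>E S). sum r V \<le> sum r' V"
proof -
  obtain r0 where r0: "r0 \<in> R_CO H V \<inter> (V \<rightarrow>\<^sub>E S)"
    using ex_R_CO[OF assms(1,4)] by blast
  define a where "a i = cond_entropy H {i} (V - {i})" for i
  \<comment> \<open>The upper end comes from \<open>r i = sum r V - sum r (V - {i})\<close> with the
    lower bounds \<open>a\<close> on the other coordinates. The point \<open>undefined\<close>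
    outside \<open>V\<close> encodes extensionality and keeps every factor compact, so Tychonoff's
    theorem applies to the product over the whole type.\<close>
  define B where
    "B i = (if i \<in> V then {a i .. sum r0 V - sum a (V - {i})} else {undefined})" for i
  \<comment> \<open>Each condition involves only finitely many coordinates, hence is closed in the
    product topology.\<close>
  define F where "F = (\<Inter>i\<in>V. {r. r i \<in> S}) \<inter>
    (\<Inter>X\<in>{X. X \<subset> V}. {r. cond_entropy H X (V - X) \<le> sum r X}) \<inter> {r. sum r V \<le> sum r0 V}"
  have cont: "continuous_on UNIV (\<lambda>r :: 'a \<Rightarrow> real. r i)" for i
    by (rule continuous_on_product_coordinates)
  have "compact (PiE UNIV B)"
    using compactin_PiE[of "\<lambda>_. euclidean" UNIV B]
    by (simp add: B_def euclidean_product_topology)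
  moreover have "closed F"
    unfolding F_def
  proof (intro closed_Int closed_INT ballI)
    show "closed {r :: 'a \<Rightarrow> real. r i \<in> S}" for i
      using closed_vimage[OF assms(3) cont] by (simp add: vimage_def)
  qed (intro closed_Collect_le continuous_on_sum continuous_on_const cont)+
  ultimately have comp: "compact (PiE UNIV B \<inter> F)"
    by (rule compact_Int_closed)
  have mem: "r \<in> PiE UNIV B \<inter> F \<longleftrightarrow>
      r \<in> R_CO H V \<inter> (V \<rightarrow>\<^sub>E S) \<and> sum r V \<le> sum r0 V" for r
  proof
    assume "r \<in> PiE UNIV B \<inter> F"
    then show "r \<in> R_CO H V \<inter> (V \<rightarrow>\<^sub>E S) \<and> sum r V \<le> sum r0 V"
      by (auto simp: R_CO_def F_def B_def PiE_iff extensional_def split: if_splits)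
  next
    assume r: "r \<in> R_CO H V \<inter> (V \<rightarrow>\<^sub>E S) \<and> sum r V \<le> sum r0 V"
    have lower: "a i \<le> r i" if "i \<in> V" for i
    proof -
      \<comment> \<open>Constraints exist only for proper subsets; here \<open>card V > 1\<close>
        enters.\<close>
      have "{i} \<subset> V"
        using that assms(2) by auto
      then show ?thesis
        using r R_CO_D[of r H V "{i}"] by (simp add: a_def)
    qed
    have "r i \<in> B i" for i
    proof (cases "i \<in> V")
      case True
      have "sum a (V - {i}) \<le> sum r (V - {i})"
        using lower by (intro sum_mono) auto
      then show ?thesis
        using True lower r sum.remove[OF assms(1) True, of r] by (auto simp: B_def)
    next
      case False
      then show ?thesis
        using r by (auto simp: B_def PiE_iff extensional_def)
    qed
    then show "r \<in> PiE UNIV B \<inter> F"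
      using r by (auto simp: R_CO_def F_def)
  qed
  have "continuous_on (PiE UNIV B \<inter> F) (\<lambda>r. sum r V)"
    by (intro continuous_on_sum continuous_on_subset[OF cont]) auto
  moreover have "r0 \<in> PiE UNIV B \<inter> F"
    unfolding mem using r0 by simp
  then have "PiE UNIV B \<inter> F \<noteq> {}"
    by (metis empty_iff)
  ultimately obtain r where r: "r \<in> PiE UNIV B \<inter> F"
      and min: "\<forall>r' \<in> PiE UNIV B \<inter> F. sum r V \<le> sum r' V"
    using continuous_attains_inf[of "PiE UNIV B \<inter> F" "\<lambda>r. sum r V"] comp by metis
  show ?thesis
  proof (intro bexI[of _ r] ballI)
    fix r' assume "r' \<in> R_CO H V \<inter> (V \<rightarrow>\<^sub>E S)"
    \<comment> \<open>A feasible vector outside the compact set has a sum above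
      \<open>sum r0 V\<close>, which already bounds \<open>sum r V\<close>.\<close>
    then show "sum r V \<le> sum r' V"
      using r min unfolding mem Ball_def by (meson linear order_trans)
  qed (use r in \<open>simp only: mem\<close>)
qed

text \<open>\<open>LEAST\<close> on the reals is informative only when a least element exists;
  attainment identifies it with the sum of a feasible vector.\<close>

lemma Least_R_CO_attained:
  fixes S :: "real set"
  assumes "finite V" "card V > 1" "closed S" "\<And>c. \<exists>s\<in>S. c \<le> s"
  shows "\<exists>r \<in> R_CO H V \<inter> (V \<rightarrow>\<^sub>E S).
    (LEAST s. s \<in> {sum r V | r. r \<in> R_CO H V \<inter> (V \<rightarrow>\<^sub>E S)}) = sum r V"
proof -
  obtain r where "r \<in> R_CO H V \<inter> (V \<rightarrow>\<^sub>E S)"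
      "\<forall>r' \<in> R_CO H V \<inter> (V \<rightarrow>\<^sub>E S). sum r V \<le> sum r' V"
    using R_CO_attains_min[OF assms] by blast
  then show ?thesis
    by (intro bexI[of _ r] Least_equality) auto
qed

lemma R_ACO_attained:
  assumes "finite V" "card V > 1"
  shows "\<exists>r \<in> R_CO H V. R_ACO H V = sum r V"
proof -
  have "R_CO H V \<inter> (V \<rightarrow>\<^sub>E UNIV) = R_CO H V"
    by (auto simp: R_CO_def)
  then show ?thesis
    using Least_R_CO_attained[OF assms closed_UNIV, of H] by (auto simp: R_ACO_def)
qed

lemma R_NCO_attained:
  assumes "finite V" "card V > 1"
  shows "\<exists>r \<in> R_CO H V \<inter> (V \<rightarrow>\<^sub>E \<int>). R_NCO H V = sum r V"
  unfolding R_NCO_def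
proof (rule Least_R_CO_attained[OF assms closed_Ints])
  show "\<exists>s\<in>\<int>. c \<le> s" for c :: real
    by (meson Ints_of_int le_of_int_ceiling)
qed

lemma Max_phi_le_sum:
  assumes "finite V" "card V > 1" "r \<in> R_CO H V"
  shows "(MAX i\<in>V. max (phi H V {{i}, V - {i}}) (phi H V {{m} | m. m \<in> V})) \<le> sum r V"
proof -
  have singletons: "{{m} | m. m \<in> V} = (\<lambda>m. {m}) ` V"
    by auto
  have "phi H V {{m} | m. m \<in> V} \<le> sum r V"
    using assms unfolding singletons
    by (intro phi_le_sum) (auto simp: partition_on_def disjoint_def card_image)
  moreover have "phi H V {{i}, V - {i}} \<le> sum r V" if "i \<in> V" for i
  proof -
    \<comment> \<open>Both blocks must be nonempty for a partition; they are disjoint, hence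
      distinct, and the partition has cardinality 2.\<close>
    have "card (V - {i}) > 0"
      using assms(2) that by simp
    then have "V - {i} \<noteq> {}"
      by (metis card.empty less_irrefl)
    then show ?thesis
      using that
      by (intro phi_le_sum[OF assms(1) _ _ assms(3)])
        (auto simp: partition_on_def disjoint_def card_insert_if)
  qed
  moreover have "V \<noteq> {}"
    using assms(2) by auto
  ultimately show ?thesis
    using assms(1) by simp
qed

theorem mainTheorem5:
  fixes M :: "'a measure" and b :: real
    and V :: "'v set" and Z :: "'v \<Rightarrow> 'a \<Rightarrow> 'b" and A :: "'v \<Rightarrow> 'b set"
    and H :: "'v set \<Rightarrow> real"
  assumes "information_space M b"
    and "finite V" and "card V > 1"
    and "\<And>i. i \<in> V \<Longrightarrow> countable (A i)"
    and "\<And>i. i \<in> V \<Longrightarrow> Z i \<in> M \<rightarrow>\<^sub>M count_space (A i)"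
    and "\<And>X. X \<subseteq> V \<Longrightarrow> information_space.has_finite_entropy M b Z X"
  defines "H \<equiv> information_space.joint_entropy M b Z"
  shows "R_ACO H V \<ge> (MAX i\<in>V. max (phi H V {{i}, V - {i}}) (phi H V {{m} | m. m \<in> V}))
    \<and> R_NCO H V \<ge> real_of_int \<lceil>MAX i\<in>V. max (phi H V {{i}, V - {i}}) (phi H V {{m} | m. m \<in> V})\<rceil>"
    (is "?M \<le> _ \<and> _")
proof
  obtain r where "r \<in> R_CO H V" "R_ACO H V = sum r V"
    using R_ACO_attained[OF assms(2,3)] by blast
  then show "?M \<le> R_ACO H V"
    using Max_phi_le_sum[OF assms(2,3)] by simp
next
  obtain r where r: "r \<in> R_CO H V" "r \<in> V \<rightarrow>\<^sub>E \<int>" "R_NCO H V = sum r V"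
    using R_NCO_attained[OF assms(2,3), of H] by blast
  \<comment> \<open>An integer above a real bound is also above its ceiling.\<close>
  have "sum r V \<in> \<int>"
    using r(2) by (intro Ints_sum) auto
  then obtain k where k: "sum r V = real_of_int k"
    by (rule Ints_cases)
  show "real_of_int \<lceil>?M\<rceil> \<le> R_NCO H V"
    using Max_phi_le_sum[OF assms(2,3) r(1)] by (simp add: r(3) k ceiling_le_iff)
qed

end
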